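(* Let $\mathtt{pl}:\mathscr{L}_{\mathsf{BD}}\to[0,1]$ be a function on $\mathsf{BD}$ formulas satisfying the axioms of a general plausibility function, i.e.: (i) if $\varphi\vdash_{\mathsf{BD}}\psi$ then $\mathtt{pl}(\varphi)\le\mathtt{pl}(\psi)$; (ii) for every $k\ge1$ and all $\varphi_1,\dots,\varphi_k\in\mathscr{L}_{\mathsf{BD}}$, $$\mathtt{pl}\Big(\bigwedge_{i=1}^k\varphi_i\Big)\ \le \sum_{\varnothing\neq J\subseteq\{1,\dots,k\}}(-1)^{|J|+1}\,\mathtt{pl}\Big(\bigvee_{j\in J}\varphi_j\Big).$$ Then, for the canonical model $\mathscr{M}_c=\langle\mathcal P(\mathsf{Lit}),v^+_c,v^-_c\rangle$, there is a plausibility function $\mathtt{pl}'$ on the powerset $\mathcal P(\mathcal P(\mathsf{Lit}))$ of its set of states such that $\mathtt{pl}(\varphi)=\mathtt{pl}'(|\varphi|^+)$ for every $\varphi\in\mathscr{L}_{\mathsf{BD}}$.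
   Context: Fix a finite set $\mathtt{Prop}$ of propositional variables; $\mathscr{L}_{\mathsf{BD}}$ is the set of formulas built from $\mathtt{Prop}$ with $\neg,\wedge,\vee$, and $\mathsf{Lit}=\mathtt{Prop}\cup\{\neg p:p\in\mathtt{Prop}\}$. A BD model is $\langle W,v^+,v^-\rangle$ with $W\neq\varnothing$ and $v^+,v^-:\mathtt{Prop}\to\mathcal P(W)$; support relations: $w\vDash^+p$ iff $w\in v^+(p)$; $w\vDash^-p$ iff $w\in v^-(p)$; $w\vDash^\pm\neg\varphi$ iff $w\vDash^\mp\varphi$; $w\vDash^+\varphi\wedge\psi$ iff both $w\vDash^+\varphi,w\vDash^+\psi$; $w\vDash^-\varphi\wedge\psi$ iff $w\vDash^-\varphi$ or $w\vDash^-\psi$; $w\vDash^+\varphi\vee\psi$ iff $w\vDash^+\varphi$ or $w\vDash^+\psi$; $w\vDash^-\varphi\vee\psi$ iff both $w\vDash^-\varphi,w\vDash^-\psi$. $|\varphi|^\pm=\{w:w\vDash^\pm\varphi\}$. $\varphi\vdash_{\mathsf{BD}}\psi$ means that in every BD model $|\varphi|^+\subseteq|\psi|^+$ and $|\psi|^-\subseteq|\varphi|^-$. The canonical model has states $\mathcal P(\mathsf{Lit})$, $v^+_c(p)=\{s:p\in s\}$, $v^-_c(p)=\{s:\neg p\in s\}$. A plausibility function on $\mathcal P(S)$ is a monotone map $q:\mathcal P(S)\to[0,1]$ such that for all $k\ge1$ and $A_1,\dots,A_k\subseteq S$, $q(\bigcap_iA_i)\le\sum_{\varnothing\ne J\subseteq\{1..k\}}(-1)^{|J|+1}q(\bigcup_{j\in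 J}A_j)$, with $q(\varnothing)=0$ and $q(S)=1$. *)

theory Defs
  imports Complex_Main
begin

datatype 'p fm =
    Atom 'p
  | Neg "'p fm"
  | Conj "'p fm" "'p fm"
  | Disj "'p fm" "'p fm"

definition L_BD :: "'p set \<Rightarrow> 'p fm set" where
  "L_BD Prop = {\<phi>. set_fm \<phi> \<subseteq> Prop}"

definition Lit :: "'p set \<Rightarrow> 'p fm set" where
  "Lit Prop = Atom ` Prop \<union> {Neg (Atom p) | p. p \<in> Prop}"

text \<open>The language has no constants, so finite conjunctions and disjunctions are meant for nonempty
  lists only; they are nested to the right. On the empty list they are left unspecified.\<close>

fun big_conj :: "'p fm list \<Rightarrow> 'p fm" where
  "big_conj [\<phi>] = \<phi>"
| "big_conj (\<phi> # \<psi> # \<chi>s) = Conj \<phi> (big_conj (\<psi> # \<chi>s))"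

fun big_disj :: "'p fm list \<Rightarrow> 'p fm" where
  "big_disj [\<phi>] = \<phi>"
| "big_disj (\<phi> # \<psi> # \<chi>s) = Disj \<phi> (big_disj (\<psi> # \<chi>s))"

text \<open>Indexed versions for a finite nonempty index set, taken in increasing order of the index.\<close>

definition Conj_over :: "nat set \<Rightarrow> (nat \<Rightarrow> 'p fm) \<Rightarrow> 'p fm" where
  "Conj_over J \<phi> = big_conj (map \<phi> (sorted_list_of_set J))"

definition Disj_over :: "nat set \<Rightarrow> (nat \<Rightarrow> 'p fm) \<Rightarrow> 'p fm" where
  "Disj_over J \<phi> = big_disj (map \<phi> (sorted_list_of_set J))"

record ('p, 'w) bd_model =
  states :: "'w set"
  vpos :: "'p \<Rightarrow> 'w set"
  vneg :: "'p \<Rightarrow> 'w set"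

definition is_bd_model :: "'p set \<Rightarrow> ('p, 'w) bd_model \<Rightarrow> bool" where
  "is_bd_model Prop M \<longleftrightarrow>
     states M \<noteq> {} \<and> (\<forall>p\<in>Prop. vpos M p \<subseteq> states M \<and> vneg M p \<subseteq> states M)"

fun supp_pos :: "('p, 'w) bd_model \<Rightarrow> 'w \<Rightarrow> 'p fm \<Rightarrow> bool"
and supp_neg :: "('p, 'w) bd_model \<Rightarrow> 'w \<Rightarrow> 'p fm \<Rightarrow> bool" where
  "supp_pos M w (Atom p) \<longleftrightarrow> w \<in> vpos M p"
| "supp_pos M w (Neg \<phi>) \<longleftrightarrow> supp_neg M w \<phi>"
| "supp_pos M w (Conj \<phi> \<psi>) \<longleftrightarrow> supp_pos M w \<phi> \<and> supp_pos M w \<psi>"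
| "supp_pos M w (Disj \<phi> \<psi>) \<longleftrightarrow> supp_pos M w \<phi> \<or> supp_pos M w \<psi>"
| "supp_neg M w (Atom p) \<longleftrightarrow> w \<in> vneg M p"
| "supp_neg M w (Neg \<phi>) \<longleftrightarrow> supp_pos M w \<phi>"
| "supp_neg M w (Conj \<phi> \<psi>) \<longleftrightarrow> supp_neg M w \<phi> \<or> supp_neg M w \<psi>"
| "supp_neg M w (Disj \<phi> \<psi>) \<longleftrightarrow> supp_neg M w \<phi> \<and> supp_neg M w \<psi>"

definition ext_pos :: "('p, 'w) bd_model \<Rightarrow> 'p fm \<Rightarrow> 'w set" where
  "ext_pos M \<phi> = {w \<in> states M. supp_pos M w \<phi>}"

definition ext_neg :: "('p, 'w) bd_model \<Rightarrow> 'p fm \<Rightarrow> 'w set" where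
  "ext_neg M \<phi> = {w \<in> states M. supp_neg M w \<phi>}"

text \<open>HOL cannot quantify over all state types inside a definition, so the type from which states
  are drawn is an explicit parameter. The choice is immaterial: see \<open>bd_entails_state_type\<close>
  below.\<close>

definition bd_entails :: "'w itself \<Rightarrow> 'p set \<Rightarrow> 'p fm \<Rightarrow> 'p fm \<Rightarrow> bool" where
  "bd_entails (T :: 'w itself) Prop \<phi> \<psi> \<longleftrightarrow>
     (\<forall>M :: ('p, 'w) bd_model. is_bd_model Prop M \<longrightarrow>
        ext_pos M \<phi> \<subseteq> ext_pos M \<psi> \<and> ext_neg M \<psi> \<subseteq> ext_neg M \<phi>)"

lemma supp_cong:
  assumes "\<And>p. w \<in> vpos M p \<longleftrightarrow> x \<in> vpos N p" and "\<And>p. w \<in> vneg M p \<longleftrightarrow> x \<in> vneg N p"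
  shows "(supp_pos M w \<phi> \<longleftrightarrow> supp_pos N x \<phi>) \<and> (supp_neg M w \<phi> \<longleftrightarrow> supp_neg N x \<phi>)"
  using assms by (induction \<phi>) auto

lemma bd_entails_change_type:
  assumes "bd_entails TYPE('v) Prop \<phi> \<psi>"
  shows "bd_entails TYPE('w) Prop \<phi> \<psi>"
proof -
  have *: "(supp_pos M w \<phi> \<longrightarrow> supp_pos M w \<psi>) \<and> (supp_neg M w \<psi> \<longrightarrow> supp_neg M w \<phi>)"
    for M :: "('a, 'w) bd_model" and w
  proof -
    define x :: 'v where "x = undefined"
    define N :: "('a, 'v) bd_model" where
      "N = \<lparr>states = {x}, vpos = (\<lambda>p. if w \<in> vpos M p then {x} else {}),
             vneg = (\<lambda>p. if w \<in> vneg M p then {x} else {})\<rparr>"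
    have eq: "(supp_pos M w \<chi> \<longleftrightarrow> supp_pos N x \<chi>) \<and> (supp_neg M w \<chi> \<longleftrightarrow> supp_neg N x \<chi>)" for \<chi>
      by (rule supp_cong) (auto simp: N_def)
    have "is_bd_model Prop N"
      by (auto simp: is_bd_model_def N_def)
    with assms have "ext_pos N \<phi> \<subseteq> ext_pos N \<psi> \<and> ext_neg N \<psi> \<subseteq> ext_neg N \<phi>"
      by (auto simp: bd_entails_def)
    moreover have "x \<in> states N"
      by (simp add: N_def)
    ultimately show ?thesis
      using eq by (auto simp: ext_pos_def ext_neg_def)
  qed
  then show ?thesis
    by (auto simp: bd_entails_def ext_pos_def ext_neg_def)
qed

lemma bd_entails_state_type:
  "bd_entails TYPE('v) Prop \<phi> \<psi> \<longleftrightarrow> bd_entails TYPE('w) Prop \<phi> \<psi>"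
  by (blast intro: bd_entails_change_type)

definition canonical_model :: "'p set \<Rightarrow> ('p, 'p fm set) bd_model" where
  "canonical_model Prop =
     \<lparr>states = Pow (Lit Prop),
      vpos = (\<lambda>p. {s \<in> Pow (Lit Prop). Atom p \<in> s}),
      vneg = (\<lambda>p. {s \<in> Pow (Lit Prop). Neg (Atom p) \<in> s})\<rparr>"

lemma is_bd_model_canonical: "is_bd_model Prop (canonical_model Prop)"
  by (auto simp: is_bd_model_def canonical_model_def)

definition plausibility_function :: "'s set \<Rightarrow> ('s set \<Rightarrow> real) \<Rightarrow> bool" where
  "plausibility_function S q \<longleftrightarrow>
     (\<forall>A\<in>Pow S. q A \<in> {0..1}) \<and>
     mono_on (Pow S) q \<and>
     (\<forall>k\<ge>1. \<forall>A :: nat \<Rightarrow> 's set. (\<forall>i\<in>{1..k}. A i \<subseteq> S) \<longrightarrow>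
        q (\<Inter>i\<in>{1..k}. A i)
          \<le> (\<Sum>J\<in>Pow {1..k} - {{}}. (-1) ^ (card J + 1) * q (\<Union>j\<in>J. A j))) \<and>
     q {} = 0 \<and>
     q S = 1"

end

theory Submission imports Defs begin

text \<open>In the canonical model the extensions of formulas are exactly the up-sets of
  \<open>Pow (Lit Prop)\<close> other than the empty and the full one, so \<open>pl\<close> induces a function \<open>f\<close> on those
  up-sets; put \<open>f {} = 0\<close> and \<open>f (Pow (Lit Prop)) = 1\<close>. An empty or full argument makes the
  alternating sum telescope, hence the inequality survives this extension. Finally let
  \<open>pl' A = f (up_closure A)\<close>. Since the up-closure commutes with unions and the up-closure of an
  intersection is contained in the intersection of the up-closures, the inequality passes from
  \<open>f\<close> to \<open>pl'\<close>.\<close>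

section \<open>Alternating sums\<close>

definition alt_sum :: "'i set \<Rightarrow> ('i set \<Rightarrow> real) \<Rightarrow> real" where
  "alt_sum I g = (\<Sum>J\<in>Pow I - {{}}. (-1) ^ (card J + 1) * g J)"

lemma alt_sum_cong:
  assumes "\<And>J. J \<subseteq> I \<Longrightarrow> J \<noteq> {} \<Longrightarrow> g J = h J"
  shows "alt_sum I g = alt_sum I h"
  unfolding alt_sum_def using assms by (intro sum.cong) auto

lemma alt_sum_diff: "alt_sum I (\<lambda>J. g J - h J) = alt_sum I g - alt_sum I h"
  by (simp add: alt_sum_def sum_subtractf right_diff_distrib sum_negf)

text \<open>The nonempty subsets of \<open>insert i I\<close> are \<open>{i}\<close>, the nonempty
  subsets \<open>J\<close> of \<open>I\<close>, and the sets \<open>insert i J\<close>. Inserting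
  \<open>i\<close> flips the sign, so the last two kinds pair up into differences.\<close>

lemma alt_sum_insert:
  assumes "finite I" "i \<notin> I"
  shows "alt_sum (insert i I) g = g {i} + alt_sum I (\<lambda>J. g J - g (insert i J))"
proof -
  have fin: "finite (Pow I - {{}})"
    using assms by simp
  have inj: "inj_on (insert i) (Pow I - {{}})"
    using assms(2) by (auto simp: inj_on_def)
  have split: "Pow (insert i I) - {{}} = insert {i} ((Pow I - {{}}) \<union> insert i ` (Pow I - {{}}))"
    using assms(2) by (auto simp: Pow_insert)
  have "alt_sum (insert i I) g = g {i} + ((\<Sum>J\<in>Pow I - {{}}. (-1) ^ (card J + 1) * g J)
      + (\<Sum>J\<in>insert i ` (Pow I - {{}}). (-1) ^ (card J + 1) * g J))"
    unfolding alt_sum_def split using assms fin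
    by (subst sum.insert) (auto intro!: sum.union_disjoint)
  also have "(\<Sum>J\<in>insert i ` (Pow I - {{}}). (-1) ^ (card J + 1) * g J)
      = (\<Sum>J\<in>Pow I - {{}}. - ((-1) ^ (card J + 1) * g (insert i J)))"
    unfolding sum.reindex[OF inj] comp_def
  proof (intro sum.cong refl)
    fix J assume "J \<in> Pow I - {{}}"
    then have "finite J" "i \<notin> J"
      using assms finite_subset by auto
    then show "(-1) ^ (card (insert i J) + 1) * g (insert i J)
        = - ((-1) ^ (card J + 1) * g (insert i J))"
      by simp
  qed
  finally show ?thesis
    by (simp add: alt_sum_def right_diff_distrib sum_subtractf sum_negf)
qed

lemma alt_sum_one:
  assumes "finite I" "I \<noteq> {}"
  shows "alt_sum I (\<lambda>_. 1) = 1"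
proof -
  from assms(2) obtain i where "i \<in> I" by blast
  then have "alt_sum I (\<lambda>_. 1) = 1 + alt_sum (I - {i}) (\<lambda>_. 1 - 1)"
    using alt_sum_insert[of "I - {i}" i "\<lambda>_. 1"] assms(1) by (simp add: insert_absorb)
  then show ?thesis
    by (simp add: alt_sum_def)
qed

text \<open>Dropping members of a family leaves index sets that are no longer initial segments; this
  lets the inequality for \<open>{1..k}\<close> serve every finite index set.\<close>

lemma alt_sum_reindex:
  assumes "bij_betw h K I"
  shows "alt_sum I g = alt_sum K (\<lambda>J. g (h ` J))"
proof -
  have inj: "inj_on h K" and im: "h ` K = I"
    using assms by (auto simp: bij_betw_def)
  have "bij_betw (image h) (Pow K - {{}}) (Pow I - {{}})"
    using bij_betw_Pow[OF assms] by (rule bij_betw_DiffI) (auto simp: bij_betw_def)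
  moreover have "card (h ` J) = card J" if "J \<in> Pow K - {{}}" for J
    using that inj by (intro card_image) (blast intro: inj_on_subset)
  ultimately show ?thesis
    unfolding alt_sum_def by (subst sum.reindex_bij_betw[symmetric]) (assumption, simp)
qed

section \<open>Plausibility functions from up-sets\<close>

definition up_closure :: "'a set \<Rightarrow> 'a set set \<Rightarrow> 'a set set" where
  "up_closure L A = {t \<in> Pow L. \<exists>s\<in>A. s \<subseteq> t}"

text \<open>Defined as fixed points of the closure, so that composing with
  \<open>up_closure L\<close> leaves the values on up-sets unchanged.\<close>

definition up_sets :: "'a set \<Rightarrow> 'a set set set" where
  "up_sets L = {U. up_closure L U = U}"

lemma up_sets_iff: "U \<in> up_sets L \<longleftrightarrow> U \<subseteq> Pow L \<and> (\<forall>s\<in>U. \<forall>t\<subseteq>L. s \<subseteq> t \<longrightarrow> t \<in> U)"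
  by (auto simp: up_sets_def up_closure_def set_eq_iff subset_iff)

lemma up_closure_in_up_sets: "up_closure L A \<in> up_sets L"
  unfolding up_sets_iff up_closure_def by blast

lemma up_sets_Inter:
  assumes "I \<noteq> {}" and U: "\<And>i. i \<in> I \<Longrightarrow> U i \<in> up_sets L"
  shows "(\<Inter>i\<in>I. U i) \<in> up_sets L"
  unfolding up_sets_iff
proof (intro conjI ballI allI impI INT_I)
  show "(\<Inter>i\<in>I. U i) \<subseteq> Pow L"
    using assms by (meson INF_lower2 ex_in_conv up_sets_iff)
  show "t \<in> U i" if "s \<in> (\<Inter>i\<in>I. U i)" "t \<subseteq> L" "s \<subseteq> t" "i \<in> I" for s t i
    using U[OF \<open>i \<in> I\<close>] that unfolding up_sets_iff by blast
qed

lemma plausibility_function_up_closure: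
  assumes range: "\<And>U. U \<in> up_sets L \<Longrightarrow> f U \<in> {0..1}"
    and mono: "mono_on (up_sets L) f"
    and ineq: "\<And>k U. k \<ge> 1 \<Longrightarrow> (\<And>i::nat. i \<in> {1..k} \<Longrightarrow> U i \<in> up_sets L) \<Longrightarrow>
      f (\<Inter>i\<in>{1..k}. U i) \<le> alt_sum {1..k} (\<lambda>J. f (\<Union>j\<in>J. U j))"
    and "f {} = 0" "f (Pow L) = 1"
  shows "plausibility_function (Pow L) (\<lambda>A. f (up_closure L A))"
proof -
  have alternating: "f (up_closure L (\<Inter>i\<in>{1..k}. A i))
      \<le> (\<Sum>J\<in>Pow {1..k} - {{}}. (-1) ^ (card J + 1) * f (up_closure L (\<Union>j\<in>J. A j)))"
    if k: "k \<ge> 1" for k and A :: "nat \<Rightarrow> 'a set set"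
  proof -
    \<comment> \<open>Only an inclusion is available here, since disjoint sets may have overlapping
      up-closures; monotonicity turns it into the required direction.\<close>
    have "f (up_closure L (\<Inter>i\<in>{1..k}. A i)) \<le> f (\<Inter>i\<in>{1..k}. up_closure L (A i))"
    proof (rule mono_onD[OF mono])
      show "(\<Inter>i\<in>{1..k}. up_closure L (A i)) \<in> up_sets L"
        using k by (intro up_sets_Inter up_closure_in_up_sets) auto
      show "up_closure L (\<Inter>i\<in>{1..k}. A i) \<subseteq> (\<Inter>i\<in>{1..k}. up_closure L (A i))"
        unfolding up_closure_def by blast
    qed (rule up_closure_in_up_sets)
    also have "\<dots> \<le> alt_sum {1..k} (\<lambda>J. f (\<Union>j\<in>J. up_closure L (A j)))"
      by (rule ineq[of k "\<lambda>i. up_closure L (A i)"]) (use k up_closure_in_up_sets in auto)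
    \<comment> \<open>The terms carry alternating signs, so an inequality between them would not do;
      unions commute with closure exactly.\<close>
    also have "(\<lambda>J. f (\<Union>j\<in>J. up_closure L (A j))) = (\<lambda>J. f (up_closure L (\<Union>j\<in>J. A j)))"
    proof
      fix J
      have "(\<Union>j\<in>J. up_closure L (A j)) = up_closure L (\<Union>j\<in>J. A j)"
        unfolding up_closure_def by blast
      then show "f (\<Union>j\<in>J. up_closure L (A j)) = f (up_closure L (\<Union>j\<in>J. A j))"
        by simp
    qed
    finally show ?thesis
      by (simp add: alt_sum_def)
  qed
  have bounds: "up_closure L {} = {}" "up_closure L (Pow L) = Pow L"
    by (auto simp: up_closure_def)
  have "mono_on (Pow (Pow L)) (\<lambda>A. f (up_closure L A))"
  proof (rule mono_onI)
    fix A B :: "'a set set" assume "A \<le> B"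
    then have "up_closure L A \<subseteq> up_closure L B"
      unfolding up_closure_def by blast
    then show "f (up_closure L A) \<le> f (up_closure L B)"
      by (intro mono_onD[OF mono] up_closure_in_up_sets)
  qed
  then show ?thesis
    unfolding plausibility_function_def bounds
    using alternating range[OF up_closure_in_up_sets] assms(4,5) by blast
qed

text \<open>It suffices to have the alternating inequality for the up-sets other than \<open>{}\<close> and \<open>Pow L\<close>:
  an empty \<open>U i\<close> makes both sides vanish, and a full one can be dropped from the family.\<close>

lemma alt_sum_inequality_extend:
  assumes ineq: "\<And>I. finite I \<Longrightarrow> I \<noteq> {} \<Longrightarrow> (\<And>i. i \<in> I \<Longrightarrow> U i \<in> up_sets L - {{}, Pow L}) \<Longrightarrow>
      f (\<Inter>i\<in>I. U i) \<le> alt_sum I (\<lambda>J. f (\<Union>j\<in>J. U j))"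
    and f: "f {} = 0" "f (Pow L) = 1"
    and "finite I" "I \<noteq> {}" "\<And>i. i \<in> I \<Longrightarrow> U i \<in> up_sets L"
  shows "f (\<Inter>i\<in>I. U i) \<le> alt_sum I (\<lambda>J. f (\<Union>j\<in>J. U j))"
  using assms(4-)
proof (induction I rule: finite_psubset_induct)
  case (psubset I)
  consider (proper) "\<forall>i\<in>I. U i \<in> up_sets L - {{}, Pow L}"
    | (empty) i where "i \<in> I" "U i = {}"
    | (full) i where "i \<in> I" "U i = Pow L"
    using psubset.prems by blast
  then show ?case
  proof cases
    case proper
    then show ?thesis
      using ineq[of I] psubset by blast
  next
    case empty
    \<comment> \<open>Adding the empty \<open>U i\<close> changes no union, so all paired
      differences vanish and only \<open>f (U i) = 0\<close> remains.\<close>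
    have "alt_sum (insert i (I - {i})) (\<lambda>J. f (\<Union>j\<in>J. U j)) = 0"
      using psubset.hyps empty f by (subst alt_sum_insert) (auto simp: alt_sum_def)
    moreover have "(\<Inter>i\<in>I. U i) = {}"
      using empty by blast
    ultimately show ?thesis
      using empty f by (simp add: insert_absorb)
  next
    case full
    let ?I = "I - {i}" and ?g = "\<lambda>J. f (\<Union>j\<in>J. U j)"
    have I: "I = insert i ?I"
      using full by blast
    have sub: "U j \<subseteq> Pow L" if "j \<in> I" for j
      using psubset.prems(2)[OF that] by (auto simp: up_sets_iff)
    have "?g (insert i J) = 1" if "J \<subseteq> ?I" for J
    proof -
      have "(\<Union>j\<in>insert i J. U j) \<subseteq> Pow L"
        using that full(1) by (intro UN_least sub) auto
      then have "(\<Union>j\<in>insert i J. U j) = Pow L"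
        using full(2) by (intro antisym) auto
      then show ?thesis
        using f by simp
    qed
    \<comment> \<open>For nonempty \<open>?I\<close> the two ones cancel by
      \<open>alt_sum_one\<close>, which leaves the sum for the family without
      \<open>i\<close>.\<close>
    then have sum: "alt_sum (insert i ?I) ?g = 1 + (alt_sum ?I ?g - alt_sum ?I (\<lambda>_. 1))"
      using psubset.hyps full f
      by (simp add: alt_sum_insert alt_sum_diff[symmetric] cong: alt_sum_cong)
    \<comment> \<open>The singleton family is separate: over an empty \<open>?I\<close> the sum of
      ones is 0 and the intersection is the whole type instead of a subset of
      \<open>Pow L\<close>.\<close>
    show ?thesis
    proof (cases "?I = {}")
      case True
      then have "I = {i}"
        using full(1) by blast
      then show ?thesis
        using sum full f by (simp add: alt_sum_def)
    next
      case False
      then have "(\<Inter>j\<in>?I. U j) \<subseteq> U i"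
        unfolding full(2) by (metis DiffD1 INF_lower2 equals0I sub)
      then have "(\<Inter>i\<in>I. U i) = (\<Inter>i\<in>?I. U i)"
        using INF_insert[of U i ?I] full(1) by (simp add: insert_absorb Int_absorb1)
      moreover have "f (\<Inter>i\<in>?I. U i) \<le> alt_sum ?I ?g"
        using full False psubset.prems by (intro psubset.IH) auto
      ultimately show ?thesis
        using sum I alt_sum_one[of ?I] False psubset.hyps by simp
    qed
  qed
qed

section \<open>The canonical model\<close>

abbreviation canonical_ext :: "'p set \<Rightarrow> 'p fm \<Rightarrow> 'p fm set set" where
  "canonical_ext Prop \<equiv> ext_pos (canonical_model Prop)"

lemma L_BD_simps [simp]:
  "Atom p \<in> L_BD Prop \<longleftrightarrow> p \<in> Prop"
  "Neg \<phi> \<in> L_BD Prop \<longleftrightarrow> \<phi> \<in> L_BD Prop"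
  "Conj \<phi> \<psi> \<in> L_BD Prop \<longleftrightarrow> \<phi> \<in> L_BD Prop \<and> \<psi> \<in> L_BD Prop"
  "Disj \<phi> \<psi> \<in> L_BD Prop \<longleftrightarrow> \<phi> \<in> L_BD Prop \<and> \<psi> \<in> L_BD Prop"
  by (auto simp: L_BD_def)

lemma states_canonical [simp]: "states (canonical_model Prop) = Pow (Lit Prop)"
  by (simp add: canonical_model_def)

lemma ext_pos_Conj [simp]: "ext_pos M (Conj \<phi> \<psi>) = ext_pos M \<phi> \<inter> ext_pos M \<psi>"
  and ext_pos_Disj [simp]: "ext_pos M (Disj \<phi> \<psi>) = ext_pos M \<phi> \<union> ext_pos M \<psi>"
  by (auto simp: ext_pos_def)

lemma ext_pos_big_conj:
  "xs \<noteq> [] \<Longrightarrow> ext_pos M (big_conj xs) = (\<Inter>\<phi>\<in>set xs. ext_pos M \<phi>)"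
  by (induction xs rule: big_conj.induct) auto

lemma ext_pos_big_disj:
  "xs \<noteq> [] \<Longrightarrow> ext_pos M (big_disj xs) = (\<Union>\<phi>\<in>set xs. ext_pos M \<phi>)"
  by (induction xs rule: big_disj.induct) auto

lemma big_conj_in_L_BD: "xs \<noteq> [] \<Longrightarrow> set xs \<subseteq> L_BD Prop \<Longrightarrow> big_conj xs \<in> L_BD Prop"
  by (induction xs rule: big_conj.induct) auto

lemma big_disj_in_L_BD: "xs \<noteq> [] \<Longrightarrow> set xs \<subseteq> L_BD Prop \<Longrightarrow> big_disj xs \<in> L_BD Prop"
  by (induction xs rule: big_disj.induct) auto

lemma
  assumes "finite J" "J \<noteq> {}"
  shows ext_pos_Conj_over: "ext_pos M (Conj_over J \<phi>) = (\<Inter>j\<in>J. ext_pos M (\<phi> j))"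
    and ext_pos_Disj_over: "ext_pos M (Disj_over J \<phi>) = (\<Union>j\<in>J. ext_pos M (\<phi> j))"
    and Conj_over_in_L_BD: "(\<And>j. j \<in> J \<Longrightarrow> \<phi> j \<in> L_BD Prop) \<Longrightarrow> Conj_over J \<phi> \<in> L_BD Prop"
    and Disj_over_in_L_BD: "(\<And>j. j \<in> J \<Longrightarrow> \<phi> j \<in> L_BD Prop) \<Longrightarrow> Disj_over J \<phi> \<in> L_BD Prop"
proof -
  have "map \<phi> (sorted_list_of_set J) \<noteq> []" "set (map \<phi> (sorted_list_of_set J)) = \<phi> ` J"
    using assms by auto
  note * = this
  show "ext_pos M (Conj_over J \<phi>) = (\<Inter>j\<in>J. ext_pos M (\<phi> j))"
    unfolding Conj_over_def ext_pos_big_conj[OF *(1)] *(2) by simp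
  show "ext_pos M (Disj_over J \<phi>) = (\<Union>j\<in>J. ext_pos M (\<phi> j))"
    unfolding Disj_over_def ext_pos_big_disj[OF *(1)] *(2) by simp
  show "Conj_over J \<phi> \<in> L_BD Prop" if "\<And>j. j \<in> J \<Longrightarrow> \<phi> j \<in> L_BD Prop"
    unfolding Conj_over_def using that *(2) by (intro big_conj_in_L_BD *(1)) auto
  show "Disj_over J \<phi> \<in> L_BD Prop" if "\<And>j. j \<in> J \<Longrightarrow> \<phi> j \<in> L_BD Prop"
    unfolding Disj_over_def using that *(2) by (intro big_disj_in_L_BD *(1)) auto
qed

text \<open>Negative support of an atom is also membership of a literal, so both supports are
  monotone in the state. They are proved together because negation swaps them.\<close>

lemma supp_canonical_mono:
  assumes "s \<subseteq> t" "t \<subseteq> Lit Prop"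
  shows "(supp_pos (canonical_model Prop) s \<phi> \<longrightarrow> supp_pos (canonical_model Prop) t \<phi>) \<and>
    (supp_neg (canonical_model Prop) s \<phi> \<longrightarrow> supp_neg (canonical_model Prop) t \<phi>)"
  using assms by (induction \<phi>) (auto simp: canonical_model_def)

lemma supp_canonical_empty:
  "\<not> supp_pos (canonical_model Prop) {} \<phi> \<and> \<not> supp_neg (canonical_model Prop) {} \<phi>"
  by (induction \<phi>) (auto simp: canonical_model_def)

lemma supp_canonical_Lit:
  assumes "\<phi> \<in> L_BD Prop"
  shows "supp_pos (canonical_model Prop) (Lit Prop) \<phi> \<and> supp_neg (canonical_model Prop) (Lit Prop) \<phi>"
  using assms by (induction \<phi>) (auto simp: canonical_model_def Lit_def)

text \<open>The state \<open>Lit Prop\<close> supports every formula and the state \<open>{}\<close>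
  supports none, which rules out the two extreme up-sets.\<close>

lemma canonical_ext_in_up_sets:
  assumes "\<phi> \<in> L_BD Prop"
  shows "canonical_ext Prop \<phi> \<in> up_sets (Lit Prop) - {{}, Pow (Lit Prop)}"
proof -
  have "canonical_ext Prop \<phi> \<in> up_sets (Lit Prop)"
    using supp_canonical_mono[of _ _ Prop \<phi>] by (auto simp: up_sets_iff ext_pos_def)
  moreover have "Lit Prop \<in> canonical_ext Prop \<phi>"
    using supp_canonical_Lit[OF assms] by (simp add: ext_pos_def)
  moreover have "{} \<notin> canonical_ext Prop \<phi>"
    using supp_canonical_empty[of Prop \<phi>] by (simp add: ext_pos_def)
  ultimately show ?thesis
    by blast
qed

section \<open>Definability of up-sets by formulas\<close>

text \<open>The conjunction of the literals in \<open>s\<close> works; \<open>s\<close> must be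
  nonempty because the language has no constant for truth.\<close>

lemma ex_formula_principal:
  assumes "finite s" "s \<noteq> {}" "s \<subseteq> Lit Prop"
  shows "\<exists>\<phi>\<in>L_BD Prop. canonical_ext Prop \<phi> = {t \<in> Pow (Lit Prop). s \<subseteq> t}"
  using assms
proof (induction s rule: finite_ne_induct)
  case (singleton l)
  then have "l \<in> L_BD Prop" "canonical_ext Prop l = {t \<in> Pow (Lit Prop). {l} \<subseteq> t}"
    by (auto simp: Lit_def ext_pos_def canonical_model_def)
  then show ?case by blast
next
  case (insert l s)
  then obtain \<phi> where "\<phi> \<in> L_BD Prop" "canonical_ext Prop \<phi> = {t \<in> Pow (Lit Prop). s \<subseteq> t}"
    by auto
  moreover have "l \<in> L_BD Prop" "canonical_ext Prop l = {t \<in> Pow (Lit Prop). l \<in> t}"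
    using insert.prems by (auto simp: Lit_def ext_pos_def canonical_model_def)
  ultimately show ?case
    by (intro bexI[of _ "Conj l \<phi>"]) auto
qed

text \<open>A disjunction of formulas for the principal up-sets of the members of \<open>F\<close>.
  The state \<open>{}\<close> is excluded because it generates the full up-set, which no formula
  defines.\<close>

lemma ex_formula_up_closure:
  assumes "finite Prop" "finite F" "F \<noteq> {}" "F \<subseteq> Pow (Lit Prop) - {{}}"
  shows "\<exists>\<phi>\<in>L_BD Prop. canonical_ext Prop \<phi> = up_closure (Lit Prop) F"
  using assms(2-)
proof (induction F rule: finite_ne_induct)
  have fin: "finite (Lit Prop)"
    using assms(1) by (simp add: Lit_def)
  have principal: "\<exists>\<phi>\<in>L_BD Prop. canonical_ext Prop \<phi> = {t \<in> Pow (Lit Prop). s \<subseteq> t}"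
    if "s \<in> Pow (Lit Prop) - {{}}" for s
    using that fin by (intro ex_formula_principal) (auto intro: finite_subset)
  {
    case (singleton s)
    then show ?case
      using principal[of s] by (simp add: up_closure_def)
  next
    case (insert s F)
    then obtain \<phi> \<psi> where "\<phi> \<in> L_BD Prop" "canonical_ext Prop \<phi> = up_closure (Lit Prop) F"
      "\<psi> \<in> L_BD Prop" "canonical_ext Prop \<psi> = {t \<in> Pow (Lit Prop). s \<subseteq> t}"
      using principal[of s] by auto
    then show ?case
      by (intro bexI[of _ "Disj \<phi> \<psi>"]) (auto simp: up_closure_def)
  }
qed

lemma ex_formula_up_set:
  assumes "finite Prop" "U \<in> up_sets (Lit Prop) - {{}, Pow (Lit Prop)}"
  shows "\<exists>\<phi>\<in>L_BD Prop. canonical_ext Prop \<phi> = U"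
proof -
  have "U \<subseteq> Pow (Lit Prop)"
    using assms(2) by (simp add: up_sets_iff)
  \<comment> \<open>An up-set containing the least state \<open>{}\<close> would be all of
    \<open>Pow (Lit Prop)\<close>.\<close>
  moreover have "{} \<notin> U"
    using assms(2) by (auto simp: up_sets_iff)
  moreover have "finite U"
    using \<open>U \<subseteq> Pow (Lit Prop)\<close> by (rule finite_subset) (use assms(1) in \<open>simp add: Lit_def\<close>)
  moreover have "up_closure (Lit Prop) U = U" "U \<noteq> {}"
    using assms(2) by (auto simp: up_sets_def)
  ultimately show ?thesis
    using ex_formula_up_closure[OF assms(1), of U] by auto
qed

section \<open>Entailment read off from the canonical model\<close>

text \<open>For the negative supports, pass from a state to the literals whose dual it does not support;
  this turns failure of negative support into positive support.\<close>

lemma bd_entails_if_canonical_ext_subset: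
  assumes "\<phi> \<in> L_BD Prop" "\<psi> \<in> L_BD Prop" "canonical_ext Prop \<phi> \<subseteq> canonical_ext Prop \<psi>"
  shows "bd_entails TYPE('w) Prop \<phi> \<psi>"
proof -
  let ?C = "canonical_model Prop"
  have canonical: "supp_pos ?C t \<phi> \<Longrightarrow> supp_pos ?C t \<psi>" if "t \<subseteq> Lit Prop" for t
    using assms(3) that by (auto simp: ext_pos_def)
  have "(supp_pos M w \<phi> \<longrightarrow> supp_pos M w \<psi>) \<and> (supp_neg M w \<psi> \<longrightarrow> supp_neg M w \<phi>)"
    for M :: "('a, 'w) bd_model" and w
  proof -
    define s where "s = {Atom p |p. p \<in> Prop \<and> w \<in> vpos M p} \<union>
      {Neg (Atom p) |p. p \<in> Prop \<and> w \<in> vneg M p}"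
    define t where "t = {Atom p |p. p \<in> Prop \<and> w \<notin> vneg M p} \<union>
      {Neg (Atom p) |p. p \<in> Prop \<and> w \<notin> vpos M p}"
    have st: "s \<subseteq> Lit Prop" "t \<subseteq> Lit Prop"
      by (auto simp: s_def t_def Lit_def)
    have pos: "(supp_pos ?C s \<chi> \<longleftrightarrow> supp_pos M w \<chi>) \<and> (supp_neg ?C s \<chi> \<longleftrightarrow> supp_neg M w \<chi>)"
      if "\<chi> \<in> L_BD Prop" for \<chi>
      using that st by (induction \<chi>) (auto simp: canonical_model_def s_def)
    have neg: "(supp_pos ?C t \<chi> \<longleftrightarrow> \<not> supp_neg M w \<chi>) \<and> (supp_neg ?C t \<chi> \<longleftrightarrow> \<not> supp_pos M w \<chi>)"
      if "\<chi> \<in> L_BD Prop" for \<chi>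
      using that st by (induction \<chi>) (auto simp: canonical_model_def t_def)
    \<comment> \<open>The state \<open>s\<close> yields the positive half. At \<open>t\<close> the
      inclusion says that failure of negative support passes from \<open>\<phi>\<close> to
      \<open>\<psi>\<close>, whose contrapositive is the negative half.\<close>
    show ?thesis
      using canonical[OF st(1)] canonical[OF st(2)] pos neg assms(1,2) by blast
  qed
  then show ?thesis
    by (auto simp: bd_entails_def ext_pos_def ext_neg_def)
qed

section \<open>Transfer of \<open>pl\<close> to up-sets\<close>

theorem mainTheorem2:
  fixes Prop :: "'p set" and pl :: "'p fm \<Rightarrow> real"
  assumes "finite Prop"
    and "\<And>\<phi>. \<phi> \<in> L_BD Prop \<Longrightarrow> pl \<phi> \<in> {0..1}"
    and "\<And>\<phi> \<psi>. \<phi> \<in> L_BD Prop \<Longrightarrow> \<psi> \<in> L_BD Prop \<Longrightarrow>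
           bd_entails TYPE('w) Prop \<phi> \<psi> \<Longrightarrow> pl \<phi> \<le> pl \<psi>"
    and "\<And>(k::nat) \<phi> :: nat \<Rightarrow> 'p fm. k \<ge> 1 \<Longrightarrow> (\<And>i. i \<in> {1..k} \<Longrightarrow> \<phi> i \<in> L_BD Prop) \<Longrightarrow>
           pl (Conj_over {1..k} \<phi>)
             \<le> (\<Sum>J\<in>Pow {1..k} - {{}}. (-1) ^ (card J + 1) * pl (Disj_over J \<phi>))"
  shows "\<exists>pl' :: 'p fm set set \<Rightarrow> real.
           plausibility_function (states (canonical_model Prop)) pl' \<and>
           (\<forall>\<phi>\<in>L_BD Prop. pl \<phi> = pl' (ext_pos (canonical_model Prop) \<phi>))"
proof -
  let ?L = "Lit Prop"
  let ?D = "up_sets ?L - {{}, Pow ?L}"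
  define form where "form U = (SOME \<phi>. \<phi> \<in> L_BD Prop \<and> canonical_ext Prop \<phi> = U)" for U
  define f where "f U = (if U = {} then 0 else if U = Pow ?L then 1 else pl (form U))" for U
  have form: "form U \<in> L_BD Prop" "canonical_ext Prop (form U) = U" if "U \<in> ?D" for U
    using someI_ex[of "\<lambda>\<phi>. \<phi> \<in> L_BD Prop \<and> canonical_ext Prop \<phi> = U"]
      ex_formula_up_set[OF assms(1) that] by (auto simp: form_def)
  have pl_mono: "pl \<phi> \<le> pl \<psi>"
    if "\<phi> \<in> L_BD Prop" "\<psi> \<in> L_BD Prop" "canonical_ext Prop \<phi> \<subseteq> canonical_ext Prop \<psi>" for \<phi> \<psi>
    by (rule assms(3)[OF that(1,2) bd_entails_if_canonical_ext_subset[OF that]])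
  \<comment> \<open>The choice made by \<open>form\<close> does not matter: formulas with equal
    canonical extensions have equal \<open>pl\<close>, by \<open>pl_mono\<close> in both
    directions.\<close>
  have f_ext: "f (canonical_ext Prop \<phi>) = pl \<phi>" if "\<phi> \<in> L_BD Prop" for \<phi>
  proof -
    note D = canonical_ext_in_up_sets[OF that]
    have "pl (form (canonical_ext Prop \<phi>)) = pl \<phi>"
      using that form[OF D] by (intro antisym pl_mono) simp_all
    then show ?thesis
      using D by (simp add: f_def)
  qed
  have f_form: "f U = pl (form U)" if "U \<in> ?D" for U
    using f_ext[OF form(1)] form(2) that by simp
  have f_bounds [simp]: "f {} = 0" "f (Pow ?L) = 1"
    by (auto simp: f_def)
  have range: "f U \<in> {0..1}" if "U \<in> up_sets ?L" for U
    using assms(2)[OF form(1)[of U]] that by (auto simp: f_def)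
  have mono: "mono_on (up_sets ?L) f"
  proof (rule mono_onI)
    fix U V assume UV: "U \<in> up_sets ?L" "V \<in> up_sets ?L" "U \<le> V"
    show "f U \<le> f V"
    proof (cases "U \<in> ?D \<and> V \<in> ?D")
      case True
      then show ?thesis
        using UV(3) form by (simp add: f_form pl_mono)
    next
      case False
      have "V \<subseteq> Pow ?L"
        using UV by (simp add: up_sets_iff)
      \<comment> \<open>One of the two sets is extreme. If \<open>U\<close> is full or
        \<open>V\<close> is empty, then \<open>U \<le> V\<close> forces equality.\<close>
      then have "U = {} \<or> V = Pow ?L \<or> U = V"
        using False UV by blast
      moreover have "0 \<le> f V" "f U \<le> 1"
        using range UV(1,2) by auto
      ultimately show ?thesis
        by (elim disjE) simp_all
    qed
  qed
  have proper: "f (\<Inter>i\<in>{1..k}. U i) \<le> alt_sum {1..k} (\<lambda>J. f (\<Union>j\<in>J. U j))"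
    if k: "k \<ge> 1" and U: "\<And>i. i \<in> {1..k} \<Longrightarrow> U i \<in> ?D" for k and U :: "nat \<Rightarrow> _"
  proof -
    let ?\<phi> = "\<lambda>i. form (U i)"
    have L: "?\<phi> i \<in> L_BD Prop" if "i \<in> {1..k}" for i
      using form(1)[OF U[OF that]] .
    have "pl (Conj_over {1..k} ?\<phi>) = f (\<Inter>i\<in>{1..k}. U i)"
    proof -
      have fin: "finite {1..k}" "{1..k} \<noteq> {}"
        using k by auto
      have "Conj_over {1..k} ?\<phi> \<in> L_BD Prop"
        using fin L by (rule Conj_over_in_L_BD)
      moreover have "canonical_ext Prop (Conj_over {1..k} ?\<phi>) = (\<Inter>i\<in>{1..k}. U i)"
        unfolding ext_pos_Conj_over[OF fin]
        by (intro INF_cong refl) (use form(2)[OF U] in simp)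
      ultimately show ?thesis
        using f_ext by metis
    qed
    moreover have "alt_sum {1..k} (\<lambda>J. pl (Disj_over J ?\<phi>)) = alt_sum {1..k} (\<lambda>J. f (\<Union>j\<in>J. U j))"
    proof (rule alt_sum_cong)
      fix J assume J: "J \<subseteq> {1..k}" "J \<noteq> {}"
      then have fin: "finite J"
        using finite_subset by blast
      have "Disj_over J ?\<phi> \<in> L_BD Prop"
        using fin J L by (intro Disj_over_in_L_BD) auto
      moreover have "canonical_ext Prop (Disj_over J ?\<phi>) = (\<Union>j\<in>J. U j)"
        unfolding ext_pos_Disj_over[OF fin J(2)]
        by (intro SUP_cong refl form(2) U) (use J in blast)
      ultimately show "pl (Disj_over J ?\<phi>) = f (\<Union>j\<in>J. U j)"
        using f_ext by metis
    qed
    ultimately show ?thesis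
      using assms(4)[OF k, of ?\<phi>] L by (simp add: alt_sum_def)
  qed
  \<comment> \<open>This is the form that \<open>alt_sum_inequality_extend\<close> asks for;
    enumerating \<open>I\<close> by \<open>{1..card I}\<close> reduces it to
    \<open>proper\<close>.\<close>
  have proper_finite: "f (\<Inter>i\<in>I. U i) \<le> alt_sum I (\<lambda>J. f (\<Union>j\<in>J. U j))"
    if "finite I" "I \<noteq> {}" and U: "\<And>i. i \<in> I \<Longrightarrow> U i \<in> ?D" for I and U :: "nat \<Rightarrow> _"
  proof -
    obtain h where h: "bij_betw h {1..card I} I"
      using ex_bij_betw_nat_finite_1[OF \<open>finite I\<close>] by blast
    have "f (\<Inter>i\<in>{1..card I}. U (h i)) \<le> alt_sum {1..card I} (\<lambda>J. f (\<Union>j\<in>J. U (h j)))"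
    proof (rule proper)
      show "1 \<le> card I"
        using that(1,2) by (simp add: Suc_le_eq card_gt_0_iff)
      show "U (h i) \<in> ?D" if "i \<in> {1..card I}" for i
        using U bij_betwE[OF h] that by blast
    qed
    moreover have "(\<Inter>i\<in>{1..card I}. U (h i)) = (\<Inter>i\<in>I. U i)"
      using bij_betw_imp_surj_on[OF h] by (metis image_image)
    ultimately show ?thesis
      by (simp add: alt_sum_reindex[OF h])
  qed
  have "plausibility_function (Pow ?L) (\<lambda>A. f (up_closure ?L A))"
  proof (rule plausibility_function_up_closure[OF range mono])
    fix k :: nat and U :: "nat \<Rightarrow> _"
    assume k: "k \<ge> 1" and U: "\<And>i. i \<in> {1..k} \<Longrightarrow> U i \<in> up_sets ?L"
    show "f (\<Inter>i\<in>{1..k}. U i) \<le> alt_sum {1..k} (\<lambda>J. f (\<Union>j\<in>J. U j))"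
    proof (rule alt_sum_inequality_extend)
      show "{1..k} \<noteq> {}"
        using k by simp
    qed (fact proper_finite f_bounds finite_atLeastAtMost U)+
  qed simp_all
  moreover have "pl \<phi> = f (up_closure ?L (canonical_ext Prop \<phi>))" if "\<phi> \<in> L_BD Prop" for \<phi>
    using f_ext[OF that] canonical_ext_in_up_sets[OF that] by (simp add: up_sets_def)
  ultimately show ?thesis
    by (intro exI[of _ "\<lambda>A. f (up_closure ?L A)"]) simp
qed

end
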